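(* For every positive integer $n$, the number of permutations of $[n]$ having a positive up-down sequence is $[(n-1)!!]^2$ if $n$ is even and $n!!\,(n-2)!!$ if $n$ is odd. The number of permutations of $[n]$ having a Dyck up-down sequence is $(n-1)!!\,(n-3)!!$ if $n$ is even and $0$ if $n$ is odd.
   Context: For a permutation $\sigma=\sigma_1\ldots\sigma_n$ of $[n]=\{1,\ldots,n\}$, an ascent is an index $i<n$ with $\sigma_i<\sigma_{i+1}$ and a descent is an index $i<n$ with $\sigma_i>\sigma_{i+1}$. The permutation has a positive up-down sequence if for all $j\le n$ the number of ascents less than $j$ is at most the number of descents less than $j$. It has a Dyck up-down sequence if it has exactly one more ascent than descents but for all $j<n$ the number of ascents less than $j$ is at most the number of descents less than $j$. Double factorials: $m!!=m(m-2)(m-4)\cdots$ down to $1$ or $2$ for $m\ge1$, with the convention $0!!=(-1)!!=1$. *)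

theory Defs
  imports Main
begin

text \<open>Double factorial m!! on naturals, with 0!! = 1.  The convention (-1)!! = 1
  is realised by truncated natural subtraction (e.g. (2-3)!! = 0!! = 1).\<close>
fun dfact :: "nat \<Rightarrow> nat" where
  "dfact 0 = 1"
| "dfact (Suc 0) = 1"
| "dfact (Suc (Suc m)) = Suc (Suc m) * dfact m"

text \<open>Permutations of [n] = {1..n}, in one-line notation as lists
  sigma_1 ... sigma_n, where sigma_i = xs ! (i - 1).\<close>
definition perms :: "nat \<Rightarrow> nat list set" where
  "perms n = {xs. distinct xs \<and> set xs = {1..n}}"

definition is_ascent :: "nat list \<Rightarrow> nat \<Rightarrow> bool" where
  "is_ascent xs i \<longleftrightarrow> 1 \<le> i \<and> i < length xs \<and> xs ! (i - 1) < xs ! i"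

definition is_descent :: "nat list \<Rightarrow> nat \<Rightarrow> bool" where
  "is_descent xs i \<longleftrightarrow> 1 \<le> i \<and> i < length xs \<and> xs ! (i - 1) > xs ! i"

definition asc_below :: "nat list \<Rightarrow> nat \<Rightarrow> nat" where
  "asc_below xs j = card {i. is_ascent xs i \<and> i < j}"

definition desc_below :: "nat list \<Rightarrow> nat \<Rightarrow> nat" where
  "desc_below xs j = card {i. is_descent xs i \<and> i < j}"

definition positive_updown :: "nat list \<Rightarrow> bool" where
  "positive_updown xs \<longleftrightarrow> (\<forall>j \<le> length xs. asc_below xs j \<le> desc_below xs j)"

definition dyck_updown :: "nat list \<Rightarrow> bool" where
  "dyck_updown xs \<longleftrightarrow>
     card {i. is_ascent xs i} = card {i. is_descent xs i} + 1 \<and>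
     (\<forall>j < length xs. asc_below xs j \<le> desc_below xs j)"

end

theory Submission
  imports Defs "HOL-Library.Infinite_Set" "HOL-Combinatorics.Multiset_Permutations"
    "HOL-Computational_Algebra.Formal_Power_Series"
begin

text \<open>
  Let \<open>n = 2m\<close> and consider the arrangements \<open>y\<^sub>0 \<dots> y\<^sub>n\<close> of \<open>{0..n}\<close> up to translation modulo
  \<open>n + 1\<close>. The walk whose steps are the cyclic increments \<open>(y\<^sub>i\<^sub>+\<^sub>1 - y\<^sub>i) mod (n + 1)\<close>, centred by
  \<open>(n + 1)/2\<close>, is translation invariant and has a unique minimum over the even positions. Translating
  so that the entry at the minimum is \<open>0\<close> writes the arrangement as \<open>rev as @ 0 # bs\<close>, and minimality
  says exactly that \<open>as\<close> and \<open>bs\<close> are positive: the height of the up-down path at an even position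
  is odd, hence determines the sign of the walk. As in the theorem of Sparre Andersen this gives
  \<open>(\<Sum>k\<le>m. (2m choose 2k) P(2k) P(2m - 2k)) = (2m)!\<close>, so the exponential generating function of
  \<open>P(2k)\<close> is \<open>(1 - x\<^sup>2)\<close> to the power \<open>-1/2\<close>.

  For odd \<open>n\<close> the last entry is unconstrained, so \<open>P(n) = n P(n - 1)\<close>. For even \<open>n\<close> a
  permutation whose first \<open>n - 1\<close> entries are positive is either positive or Dyck.
\<close>

section \<open>Ascent and descent counts of prefixes\<close>

lemma asc_below_0 [simp]: "asc_below xs 0 = 0" "desc_below xs 0 = 0"
  by (auto simp: asc_below_def desc_below_def)

lemma asc_below_1 [simp]: "asc_below xs (Suc 0) = 0" "desc_below xs (Suc 0) = 0"
  by (auto simp: asc_below_def desc_below_def is_ascent_def is_descent_def)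

lemma asc_below_Suc:
  assumes "1 \<le> j" "j < length xs"
  shows "asc_below xs (Suc j) = asc_below xs j + of_bool (xs ! (j - 1) < xs ! j)"
proof -
  have "{i. is_ascent xs i \<and> i < Suc j} =
      {i. is_ascent xs i \<and> i < j} \<union> (if xs ! (j - 1) < xs ! j then {j} else {})"
    using assms by (auto simp: is_ascent_def less_Suc_eq)
  then show ?thesis by (simp add: asc_below_def)
qed

lemma desc_below_Suc:
  assumes "1 \<le> j" "j < length xs"
  shows "desc_below xs (Suc j) = desc_below xs j + of_bool (xs ! j < xs ! (j - 1))"
proof -
  have "{i. is_descent xs i \<and> i < Suc j} =
      {i. is_descent xs i \<and> i < j} \<union> (if xs ! j < xs ! (j - 1) then {j} else {})"
    using assms by (auto simp: is_descent_def less_Suc_eq)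
  then show ?thesis by (simp add: desc_below_def)
qed

lemma asc_plus_desc_below:
  assumes "distinct xs" "1 \<le> j" "j \<le> length xs"
  shows "asc_below xs j + desc_below xs j + 1 = j"
  using assms(2,3)
proof (induction j rule: dec_induct)
  case (step j)
  have "xs ! (j - 1) \<noteq> xs ! j"
    using assms(1) step by (simp add: nth_eq_iff_index_eq)
  then show ?case
    using step by (auto simp: asc_below_Suc desc_below_Suc)
qed simp

lemma asc_below_length: "asc_below xs (length xs) = card {i. is_ascent xs i}"
  unfolding asc_below_def by (rule arg_cong[where f = card]) (auto simp: is_ascent_def)

lemma desc_below_length: "desc_below xs (length xs) = card {i. is_descent xs i}"
  unfolding desc_below_def by (rule arg_cong[where f = card]) (auto simp: is_descent_def)

text \<open>After \<open>j\<close> entries of a word with distinct entries, ascents and descents sum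
  to \<open>j - 1\<close>, so the height (descents minus ascents) is odd when
  \<open>j = 2 * k\<close>. Non-negative then means at least 1, that is, fewer than \<open>k\<close>
  ascents. One more step costs at most 1, so the odd positions impose nothing new.\<close>

lemma positive_updown_iff:
  assumes "distinct xs"
  shows "positive_updown xs \<longleftrightarrow>
    (\<forall>k. 1 \<le> k \<and> 2 * k \<le> length xs \<longrightarrow> asc_below xs (2 * k) + 1 \<le> k)"
proof
  assume pos: "positive_updown xs"
  show "\<forall>k. 1 \<le> k \<and> 2 * k \<le> length xs \<longrightarrow> asc_below xs (2 * k) + 1 \<le> k"
  proof (intro allI impI)
    fix k assume k: "1 \<le> k \<and> 2 * k \<le> length xs"
    then have "asc_below xs (2 * k) + desc_below xs (2 * k) + 1 = 2 * k"
      using asc_plus_desc_below[OF assms, of "2 * k"] by simp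
    moreover have "asc_below xs (2 * k) \<le> desc_below xs (2 * k)"
      using pos k by (auto simp: positive_updown_def)
    ultimately show "asc_below xs (2 * k) + 1 \<le> k" by presburger
  qed
next
  assume *: "\<forall>k. 1 \<le> k \<and> 2 * k \<le> length xs \<longrightarrow> asc_below xs (2 * k) + 1 \<le> k"
  show "positive_updown xs"
    unfolding positive_updown_def
  proof (intro allI impI)
    fix j assume j: "j \<le> length xs"
    consider "j = 0" | "j = 1" | k where "1 \<le> k" "j = 2 * k" | k where "1 \<le> k" "j = Suc (2 * k)"
      by (metis One_nat_def Suc_eq_plus1 evenE less_one linorder_not_le mult_0_right
          odd_two_times_div_two_succ)
    then show "asc_below xs j \<le> desc_below xs j"
    proof cases
      case 3
      then show ?thesis
        using *[rule_format, of k] asc_plus_desc_below[OF assms, of j] j by auto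
    next
      case 4
      then have "asc_below xs (2 * k) + 1 \<le> desc_below xs (2 * k)"
        using *[rule_format, of k] asc_plus_desc_below[OF assms, of "2 * k"] j by auto
      moreover have "asc_below xs j \<le> asc_below xs (2 * k) + 1" "desc_below xs (2 * k) \<le> desc_below xs j"
        using asc_below_Suc[of "2 * k" xs] desc_below_Suc[of "2 * k" xs] 4 j by auto
      ultimately show ?thesis by linarith
    qed auto
  qed
qed

section \<open>Words over arbitrary finite sets\<close>

definition arrangements :: "nat set \<Rightarrow> nat list set" where
  "arrangements A = {xs. distinct xs \<and> set xs = A}"

definition positive_arrangements :: "nat set \<Rightarrow> nat list set" where
  "positive_arrangements A = {xs \<in> arrangements A. positive_updown xs}"

lemma length_arrangement: "xs \<in> arrangements A \<Longrightarrow> length xs = card A"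
  by (auto simp: arrangements_def distinct_card)

lemma arrangements_eq: "arrangements A = permutations_of_set A"
  by (auto simp: arrangements_def permutations_of_set_def)

lemma finite_positive_arrangements: "finite (positive_arrangements A)"
  by (auto simp: positive_arrangements_def arrangements_eq)

lemma positive_updown_map:
  assumes "strict_mono_on (set xs) f"
  shows "positive_updown (map f xs) \<longleftrightarrow> positive_updown xs"
proof -
  have less: "f (xs ! i) < f (xs ! j) \<longleftrightarrow> xs ! i < xs ! j" if "i < length xs" "j < length xs" for i j
    using that by (intro strict_mono_on_less[OF assms]) auto
  have "is_ascent (map f xs) = is_ascent xs" "is_descent (map f xs) = is_descent xs"
    by (auto simp: is_ascent_def is_descent_def less fun_eq_iff)
  then show ?thesis
    by (simp add: positive_updown_def asc_below_def desc_below_def)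
qed

text \<open>Only comparisons between entries matter, so the increasing enumeration of
  \<open>A\<close> carries positive words over to positive words. This is needed once a permutation
  is cut into pieces whose entries are arbitrary subsets.\<close>

lemma card_positive_arrangements:
  assumes "finite A"
  shows "card (positive_arrangements A) = card (positive_arrangements {1..card A})"
proof -
  obtain f where f: "bij_betw f {..<card A} A" "strict_mono_on {..<card A} f"
    using ex_bij_betw_strict_mono_card[OF assms] by blast
  define g where "g i = f (i - 1)" for i
  have g: "bij_betw g {1..card A} A"
  proof -
    have "bij_betw (\<lambda>i. i - 1) {1..card A} {..<card A}"
      by (rule bij_betwI[of _ _ _ Suc]) auto
    from bij_betw_trans[OF this f(1)] show ?thesis
      by (simp add: g_def o_def cong: bij_betw_cong)
  qed
  have mono: "strict_mono_on {1..card A} g"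
    using f(2) unfolding g_def by (auto simp: monotone_on_def)
  have "bij_betw (map g) (positive_arrangements {1..card A}) (positive_arrangements A)"
    unfolding bij_betw_def
  proof
    show "inj_on (map g) (positive_arrangements {1..card A})"
      using g by (intro inj_on_mapI)
        (auto simp: positive_arrangements_def arrangements_def bij_betw_def intro: inj_on_subset)
    show "map g ` positive_arrangements {1..card A} = positive_arrangements A"
    proof (intro equalityI subsetI)
      fix ys assume "ys \<in> map g ` positive_arrangements {1..card A}"
      then show "ys \<in> positive_arrangements A"
        using g mono by (auto simp: positive_arrangements_def arrangements_def bij_betw_def
            positive_updown_map distinct_map)
    next
      fix ys assume ys: "ys \<in> positive_arrangements A"
      define xs where "xs = map (the_inv_into {1..card A} g) ys"
      have ysA: "set ys = A" "distinct ys" "positive_updown ys"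
        using ys by (auto simp: positive_arrangements_def arrangements_def)
      have inv: "bij_betw (the_inv_into {1..card A} g) A {1..card A}"
        using bij_betw_the_inv_into[OF g] .
      have eq: "map g xs = ys"
        unfolding xs_def map_map using g ysA
        by (intro map_idI) (auto simp: f_the_inv_into_f_bij_betw)
      have set: "set xs = {1..card A}" "distinct xs"
        using inv ysA unfolding xs_def by (auto simp: bij_betw_def distinct_map)
      have "positive_updown xs"
        using positive_updown_map[of xs g] mono eq ysA set by auto
      then show "ys \<in> map g ` positive_arrangements {1..card A}"
        using eq set by (auto simp: positive_arrangements_def arrangements_def)
    qed
  qed
  from bij_betw_same_card[OF this] show ?thesis by simp
qed

section \<open>The cyclic walk and its comparison with the up-down path\<close>

text \<open>Doubled and centred, so that a random arrangement gives a symmetric integer walk.\<close>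
definition cyc_walk :: "nat list \<Rightarrow> nat \<Rightarrow> int" where
  "cyc_walk ys q =
    (\<Sum>i<q. 2 * ((int (ys ! Suc i) - int (ys ! i)) mod int (length ys)) - int (length ys))"

text \<open>A difference of two residues lies strictly between \<open>-N\<close> and
  \<open>N\<close>, where \<open>N\<close> is the length, so reducing it modulo \<open>N\<close>
  adds \<open>N\<close> exactly at a descent. This is how the up-down sequence enters the
  walk.\<close>

lemma cyc_walk_Suc:
  assumes "q + 1 < length ys" "set ys \<subseteq> {..<length ys}"
  shows "cyc_walk ys (Suc q) = cyc_walk ys q + 2 * (int (ys ! Suc q) - int (ys ! q)
    + int (length ys) * of_bool (ys ! Suc q < ys ! q)) - int (length ys)"
proof -
  define N a b where "N = int (length ys)" and "a = int (ys ! q)" and "b = int (ys ! Suc q)"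
  have "ys ! q \<in> set ys" "ys ! Suc q \<in> set ys"
    using assms by auto
  then have ab: "0 \<le> a" "a < N" "0 \<le> b" "b < N"
    using assms(2) by (auto simp: N_def a_def b_def)
  have "(b - a) mod N = b - a + N * of_bool (b < a)"
  proof (cases "b < a")
    case True
    then have "(b - a + N) mod N = b - a + N" using ab by (intro mod_pos_pos_trivial) auto
    then show ?thesis using True by simp
  qed (use ab in auto)
  moreover have "b < a \<longleftrightarrow> ys ! Suc q < ys ! q" by (simp add: a_def b_def)
  ultimately show ?thesis by (simp add: cyc_walk_def N_def a_def b_def)
qed

text \<open>The differences telescope from the entry 0 to \<open>bs ! (r - 1)\<close>, and each
  descent adds \<open>N\<close>. The first step leaves 0 and is therefore never a descent.\<close>

lemma cyc_walk_right:
  assumes ys: "ys = rev as @ 0 # bs" "set ys \<subseteq> {..<length ys}"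
    and r: "1 \<le> r" "r \<le> length bs"
  shows "cyc_walk ys (length as + r) - cyc_walk ys (length as) =
    2 * (int (bs ! (r - 1)) + int (length ys) * int (desc_below bs r)) - int r * int (length ys)"
  using r
proof (induction r rule: dec_induct)
  case base
  have "cyc_walk ys (Suc (length as)) =
    cyc_walk ys (length as) + 2 * (int (ys ! Suc (length as)) - int (ys ! length as)
    + int (length ys) * of_bool (ys ! Suc (length as) < ys ! length as)) - int (length ys)"
    by (rule cyc_walk_Suc) (use ys base in auto)
  moreover have "ys ! length as = 0" "ys ! Suc (length as) = bs ! 0"
    by (auto simp: ys(1) nth_append)
  ultimately show ?case by simp
next
  case (step r)
  have "cyc_walk ys (Suc (length as + r)) =
    cyc_walk ys (length as + r) + 2 * (int (ys ! Suc (length as + r)) - int (ys ! (length as + r))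
    + int (length ys) * of_bool (ys ! Suc (length as + r) < ys ! (length as + r))) - int (length ys)"
    by (rule cyc_walk_Suc) (use ys step in auto)
  moreover have "ys ! (length as + r) = bs ! (r - 1)" "ys ! Suc (length as + r) = bs ! r"
    using step by (auto simp: ys(1) nth_append nth_Cons')
  ultimately show ?case
    using step desc_below_Suc[of r bs] by (simp add: algebra_simps)
qed

text \<open>The word \<open>as\<close> is read leftwards from 0, so its ascents are descents of the
  walk. The extra 1 is the descent from \<open>as ! 0\<close> into 0, which is why
  \<open>0 \<notin> set as\<close> is assumed.\<close>

lemma cyc_walk_left:
  assumes ys: "ys = rev as @ 0 # bs" "set ys \<subseteq> {..<length ys}" "0 \<notin> set as"
    and r: "1 \<le> r" "r \<le> length as"
  shows "cyc_walk ys (length as) - cyc_walk ys (length as - r) =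
    2 * (int (length ys) * (1 + int (asc_below as r)) - int (as ! (r - 1))) - int r * int (length ys)"
  using r
proof (induction r rule: dec_induct)
  case base
  have "cyc_walk ys (Suc (length as - 1)) =
    cyc_walk ys (length as - 1) + 2 * (int (ys ! Suc (length as - 1)) - int (ys ! (length as - 1))
    + int (length ys) * of_bool (ys ! Suc (length as - 1) < ys ! (length as - 1))) - int (length ys)"
    by (rule cyc_walk_Suc) (use ys base in auto)
  moreover have "ys ! length as = 0" "ys ! (length as - 1) = as ! 0" "Suc (length as - 1) = length as"
    using base by (auto simp: ys(1) nth_append rev_nth)
  moreover have "as ! 0 > 0"
    using ys(3) base by (metis gr0I less_le_trans nth_mem zero_less_one)
  ultimately show ?case by simp
next
  case (step r)
  \<comment> \<open>Going one place further left prepends the walk step from \<open>as ! r\<close>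
    to \<open>as ! (r - 1)\<close>, a descent exactly when \<open>r\<close> is an ascent of
    \<open>as\<close>.\<close>
  define s where "s = length as - Suc r"
  have "cyc_walk ys (Suc s) = cyc_walk ys s + 2 * (int (ys ! Suc s) - int (ys ! s)
    + int (length ys) * of_bool (ys ! Suc s < ys ! s)) - int (length ys)"
    by (rule cyc_walk_Suc) (use ys step in \<open>auto simp: s_def\<close>)
  moreover have s: "Suc s = length as - r" "length as - Suc s = r" "length as - Suc (Suc s) = r - 1"
    using step by (auto simp: s_def)
  moreover have "ys ! s = as ! r" "ys ! Suc s = as ! (r - 1)"
    using step s by (auto simp: ys(1) nth_append rev_nth)
  ultimately show ?case
    using step asc_below_Suc[of r as] unfolding s_def[symmetric] by (simp add: algebra_simps)
qed

text \<open>Up to a factor 2, a walk difference at even distance from the 0 is a multiple of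
  \<open>N\<close> corrected by a single entry \<open>v\<close> with \<open>0 < v < N\<close>. Such
  a correction never changes the verdict given by the multiple alone.\<close>

lemma mult_less_iff_nonpos:
  fixes N t v :: int
  assumes "0 < v" "v < N"
  shows "N * t < v \<longleftrightarrow> t \<le> 0"
proof
  assume "N * t < v"
  then show "t \<le> 0"
    using assms mult_left_mono[of 1 t N] by linarith
next
  assume "t \<le> 0"
  then have "N * t \<le> 0" using assms by (simp add: mult_le_0_iff)
  then show "N * t < v" using assms by linarith
qed

text \<open>At distance \<open>2 * k\<close> from the 0, the sign of the walk difference depends
  only on whether \<open>asc_below\<close> is less than \<open>k\<close>, the criterion of
  \<open>positive_updown_iff\<close>. On the right, descents are traded for ascents since together
  they number \<open>2 * k - 1\<close>. As \<open>length as\<close> is even, the even positions are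
  those at even distance from the 0.\<close>

lemma positive_pair_iff:
  assumes ys: "ys = rev as @ 0 # bs" "distinct ys" "set ys \<subseteq> {..<length ys}"
    and even: "even (length as)"
  shows "positive_updown as \<and> positive_updown bs \<longleftrightarrow>
    (\<forall>q<length ys. even q \<and> q \<noteq> length as \<longrightarrow> cyc_walk ys (length as) < cyc_walk ys q)"
proof -
  have dist: "distinct as" "distinct bs" "0 \<notin> set as" "0 \<notin> set bs"
    using ys(1,2) by auto
  have left: "asc_below as (2 * k) + 1 \<le> k \<longleftrightarrow>
      cyc_walk ys (length as) < cyc_walk ys (length as - 2 * k)"
    if "1 \<le> k" "2 * k \<le> length as" for k
  proof -
    have "as ! (2 * k - 1) \<in> set as" using that by auto
    then have v: "0 < int (as ! (2 * k - 1))" "int (as ! (2 * k - 1)) < int (length ys)"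
      using dist(3) ys(1,3) by (auto intro!: gr0I)
    show ?thesis
      using cyc_walk_left[OF ys(1,3) dist(3), of "2 * k"] that
        mult_less_iff_nonpos[OF v, of "1 + int (asc_below as (2 * k)) - int k"]
      by (simp add: algebra_simps) linarith
  qed
  have right: "asc_below bs (2 * k) + 1 \<le> k \<longleftrightarrow>
      cyc_walk ys (length as) < cyc_walk ys (length as + 2 * k)"
    if "1 \<le> k" "2 * k \<le> length bs" for k
  proof -
    have "bs ! (2 * k - 1) \<in> set bs" using that by auto
    then have v: "0 < int (bs ! (2 * k - 1))" "int (bs ! (2 * k - 1)) < int (length ys)"
      using dist(4) ys(1,3) by (auto intro!: gr0I)
    have "asc_below bs (2 * k) + desc_below bs (2 * k) + 1 = 2 * k"
      using asc_plus_desc_below[OF dist(2), of "2 * k"] that by simp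
    then show ?thesis
      using cyc_walk_right[OF ys(1,3), of "2 * k"] that
        mult_less_iff_nonpos[OF v, of "int k - int (desc_below bs (2 * k))"]
      by (simp add: algebra_simps) linarith
  qed
  show ?thesis
    unfolding positive_updown_iff[OF dist(1)] positive_updown_iff[OF dist(2)]
  proof (intro iffI allI impI conjI; (elim conjE)?)
    fix q
    assume L: "\<forall>k. 1 \<le> k \<and> 2 * k \<le> length as \<longrightarrow> asc_below as (2 * k) + 1 \<le> k"
      and R: "\<forall>k. 1 \<le> k \<and> 2 * k \<le> length bs \<longrightarrow> asc_below bs (2 * k) + 1 \<le> k"
      and q: "q < length ys" "even q" "q \<noteq> length as"
    show "cyc_walk ys (length as) < cyc_walk ys q"
    proof (cases "q < length as")
      case True
      define k where "k = (length as - q) div 2"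
      have k: "2 * k = length as - q" using even q by (simp add: k_def)
      then have "1 \<le> k" "2 * k \<le> length as" "length as - 2 * k = q" using True by auto
      then show ?thesis using left[of k] L by auto
    next
      case False
      define k where "k = (q - length as) div 2"
      have "2 * k = q - length as" using even q by (simp add: k_def)
      then have "1 \<le> k" "2 * k \<le> length bs" "length as + 2 * k = q" using False q ys(1) by auto
      then show ?thesis using right[of k] R by auto
    qed
  next
    fix k
    assume *: "\<forall>q<length ys. even q \<and> q \<noteq> length as \<longrightarrow> cyc_walk ys (length as) < cyc_walk ys q"
      and k: "1 \<le> k" "2 * k \<le> length as"
    show "asc_below as (2 * k) + 1 \<le> k"
      using left[OF k] *[rule_format, of "length as - 2 * k"] k even ys(1) by auto
  next
    fix k
    assume *: "\<forall>q<length ys. even q \<and> q \<noteq> length as \<longrightarrow> cyc_walk ys (length as) < cyc_walk ys q"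
      and k: "1 \<le> k" "2 * k \<le> length bs"
    show "asc_below bs (2 * k) + 1 \<le> k"
      using right[OF k] *[rule_format, of "length as + 2 * k"] k even ys(1) by auto
  qed
qed

section \<open>Translation of words modulo their length\<close>

definition shift :: "nat \<Rightarrow> nat list \<Rightarrow> nat list" where
  "shift c ys = map (\<lambda>y. (y + c) mod length ys) ys"

lemma length_shift [simp]: "length (shift c ys) = length ys"
  by (simp add: shift_def)

lemma cyc_walk_shift:
  assumes "q < length ys"
  shows "cyc_walk (shift c ys) q = cyc_walk ys q"
proof -
  have "(int (shift c ys ! Suc i) - int (shift c ys ! i)) mod int (length ys) =
      (int (ys ! Suc i) - int (ys ! i)) mod int (length ys)" if "i < q" for i
    using that assms by (simp add: shift_def zmod_int mod_diff_eq)
  then show ?thesis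
    unfolding cyc_walk_def length_shift by (intro sum.cong) auto
qed

lemma add_mod_inject:
  fixes a b c N :: nat
  assumes "a < N" "b < N" "(a + c) mod N = (b + c) mod N"
  shows "a = b"
proof -
  have "int N dvd int a - int b"
    using assms(3) mod_eq_dvd_iff[of "int (a + c)" "int N" "int (b + c)"]
    unfolding zmod_int[symmetric] by simp
  then show ?thesis
    using zdvd_imp_le[of "int N" "int a - int b"] zdvd_imp_le[of "int N" "int b - int a"] assms(1,2)
    by (smt (verit) dvd_diff_commute of_nat_0_le_iff of_nat_less_iff of_nat_eq_iff)
qed

lemma inj_on_shift: "inj_on (shift c) {ys. set ys \<subseteq> {..<length ys}}"
proof (rule inj_onI, clarify)
  fix ys zs :: "nat list"
  assume *: "set ys \<subseteq> {..<length ys}" "set zs \<subseteq> {..<length zs}" "shift c ys = shift c zs"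
  then have len: "length ys = length zs" by (metis length_shift)
  show "ys = zs"
  proof (rule nth_equalityI)
    fix i assume i: "i < length ys"
    then have "(ys ! i + c) mod length ys = (zs ! i + c) mod length ys"
      using *(3) len by (metis length_shift nth_map shift_def)
    moreover have "ys ! i < length ys" "zs ! i < length ys"
      using * i len by (auto simp: subset_iff)
    ultimately show "ys ! i = zs ! i" using add_mod_inject by blast
  qed (fact len)
qed

lemma arrangement_upto:
  assumes "ys \<in> arrangements {0..n}"
  shows "length ys = Suc n" "set ys \<subseteq> {..<length ys}" "distinct ys"
  using assms length_arrangement[OF assms] by (auto simp: arrangements_def)

lemma shift_arrangement:
  assumes "ys \<in> arrangements {0..n}"
  shows "shift c ys \<in> arrangements {0..n}"
proof -
  note ys = arrangement_upto[OF assms]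
  have "inj_on (\<lambda>y. (y + c) mod length ys) (set ys)"
    using ys(2) by (intro inj_onI) (auto intro: add_mod_inject)
  then have "distinct (shift c ys)"
    using ys(3) by (simp add: shift_def distinct_map)
  moreover have "set (shift c ys) \<subseteq> {0..n}"
    using ys(1) by (auto simp: shift_def less_Suc_eq_le[symmetric])
  ultimately show ?thesis
    unfolding arrangements_def
    using card_subset_eq[of "{0..n}" "set (shift c ys)"] ys(1)
    by (auto simp: distinct_card)
qed

text \<open>At an even position the walk equals twice the entry, up to a constant and a multiple of
  \<open>2 * N\<close>. Equal values thus give entries congruent modulo \<open>N\<close>, and
  distinct entries below \<open>N\<close> are not congruent.\<close>

lemma cyc_walk_inj:
  assumes ys: "distinct ys" "set ys \<subseteq> {..<length ys}"
    and q: "q < length ys" "q' < length ys" "even q" "even q'"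
    and eq: "cyc_walk ys q = cyc_walk ys q'"
  shows "q = q'"
proof -
  let ?N = "int (length ys)"
  \<comment> \<open>The witness \<open>t\<close> is minus the sum of the quotients discarded by
    \<open>mod\<close>.\<close>
  have walk: "\<exists>t. cyc_walk ys q = 2 * (int (ys ! q) - int (ys ! 0)) + ?N * (2 * t - int q)" for q
  proof (induction q)
    case 0
    show ?case by (intro exI[of _ 0]) (simp add: cyc_walk_def)
  next
    case (Suc q)
    then obtain t where t: "cyc_walk ys q = 2 * (int (ys ! q) - int (ys ! 0)) + ?N * (2 * t - int q)"
      by blast
    let ?d = "int (ys ! Suc q) - int (ys ! q)"
    have "cyc_walk ys (Suc q) = cyc_walk ys q + 2 * (?d mod ?N) - ?N"
      by (simp add: cyc_walk_def)
    also have "?d mod ?N = ?d - ?N * (?d div ?N)"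
      by (simp add: minus_mult_div_eq_mod)
    finally show ?case
      using t by (intro exI[of _ "t - ?d div ?N"]) (simp add: algebra_simps)
  qed
  obtain t t' where
    "cyc_walk ys q = 2 * (int (ys ! q) - int (ys ! 0)) + ?N * (2 * t - int q)"
    "cyc_walk ys q' = 2 * (int (ys ! q') - int (ys ! 0)) + ?N * (2 * t' - int q')"
    using walk by metis
  moreover obtain k k' where k: "q = 2 * k" "q' = 2 * k'"
    using q by (auto elim!: evenE)
  ultimately have "int (ys ! q) - int (ys ! q') = ?N * (t' - t - int k' + int k)"
    using eq by (simp add: algebra_simps)
  then have "?N dvd int (ys ! q) - int (ys ! q')" by simp
  moreover have "ys ! q < length ys" "ys ! q' < length ys"
    using ys(2) q by (auto simp: subset_iff)
  ultimately have "int (ys ! q) = int (ys ! q')"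
    using zdvd_imp_le[of ?N "int (ys ! q) - int (ys ! q')"]
      zdvd_imp_le[of ?N "int (ys ! q') - int (ys ! q)"]
    by (smt (verit) dvd_diff_commute of_nat_0_le_iff of_nat_less_iff)
  then show ?thesis
    using ys(1) q by (simp add: nth_eq_iff_index_eq)
qed

section \<open>Counting positive pairs by translation classes\<close>

text \<open>A pair of positive words is stored as one arrangement. The first word is reversed so
  that both are read outwards from the 0.\<close>

definition positive_pairs :: "nat \<Rightarrow> nat list set" where
  "positive_pairs n = {ys \<in> arrangements {0..n}. \<exists>as bs. ys = rev as @ 0 # bs \<and>
     even (length as) \<and> positive_updown as \<and> positive_updown bs}"

text \<open>The strict inequality makes the position unique; \<open>cyc_walk_inj\<close> ensures
  that asking for it loses no minimum.\<close>

definition walk_min :: "nat list \<Rightarrow> nat \<Rightarrow> bool" where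
  "walk_min ys p \<longleftrightarrow> p < length ys \<and> even p \<and>
    (\<forall>q<length ys. even q \<and> q \<noteq> p \<longrightarrow> cyc_walk ys p < cyc_walk ys q)"

lemma walk_min_unique: "walk_min ys p \<Longrightarrow> walk_min ys q \<Longrightarrow> p = q"
  unfolding walk_min_def by (metis less_asym)

lemma walk_min_shift: "walk_min (shift c ys) p \<longleftrightarrow> walk_min ys p"
  unfolding walk_min_def by (auto simp: cyc_walk_shift)

lemma walk_min_exists:
  assumes "distinct ys" "set ys \<subseteq> {..<length ys}" "ys \<noteq> []"
  shows "\<exists>p. walk_min ys p"
proof -
  let ?E = "{q. q < length ys \<and> even q}"
  obtain p where p: "is_arg_min (cyc_walk ys) (\<lambda>q. q \<in> ?E) p"
    using ex_is_arg_min_if_finite[of ?E "cyc_walk ys"] assms(3) by force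
  then have "walk_min ys p"
    unfolding walk_min_def is_arg_min_def
    using cyc_walk_inj[OF assms(1,2), of p] by (metis (lifting) linorder_neqE_linordered_idom mem_Collect_eq)
  then show ?thesis ..
qed

lemma positive_pairs_iff:
  assumes "ys \<in> arrangements {0..n}"
  shows "ys \<in> positive_pairs n \<longleftrightarrow> (\<exists>p. walk_min ys p \<and> ys ! p = 0)"
proof
  note ys = arrangement_upto[OF assms]
  assume "ys \<in> positive_pairs n"
  then obtain as bs where *: "ys = rev as @ 0 # bs" "even (length as)" "positive_updown as" "positive_updown bs"
    by (auto simp: positive_pairs_def)
  then have "walk_min ys (length as)"
    using positive_pair_iff[OF *(1) ys(3,2) *(2)] by (auto simp: walk_min_def)
  moreover have "ys ! length as = 0" using *(1) by (simp add: nth_append)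
  ultimately show "\<exists>p. walk_min ys p \<and> ys ! p = 0" by blast
next
  note ys = arrangement_upto[OF assms]
  assume "\<exists>p. walk_min ys p \<and> ys ! p = 0"
  then obtain p where p: "walk_min ys p" "ys ! p = 0" by blast
  define as bs where "as = rev (take p ys)" and "bs = drop (Suc p) ys"
  have "p < length ys" using p by (simp add: walk_min_def)
  then have split: "ys = rev as @ 0 # bs" and len: "length as = p"
    using id_take_nth_drop[of p ys] p(2) by (auto simp: as_def bs_def)
  then have "positive_updown as \<and> positive_updown bs"
    using positive_pair_iff[OF split ys(3,2)] p by (auto simp: walk_min_def)
  then show "ys \<in> positive_pairs n"
    using assms split len p by (auto simp: positive_pairs_def walk_min_def)
qed

lemma nth_shift: "i < length ys \<Longrightarrow> shift c ys ! i = (ys ! i + c) mod length ys"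
  by (simp add: shift_def)

text \<open>A cycle lemma: translation fixes the location of the minimum and moves the entry there
  through all residues, so exactly one of the \<open>n + 1\<close> translates of an arrangement has
  0 at its minimum. Hence \<open>n + 1\<close> times the count is \<open>(n + 1)!\<close>.\<close>

lemma card_positive_pairs: "card (positive_pairs n) = fact n"
proof -
  have "bij_betw (\<lambda>(c, ys). shift c ys) ({0..n} \<times> positive_pairs n) (arrangements {0..n})"
    unfolding bij_betw_def
  proof
    show "inj_on (\<lambda>(c, ys). shift c ys) ({0..n} \<times> positive_pairs n)"
    proof (rule inj_onI, clarify)
      fix c ys c' ys'
      assume c: "c \<in> {0..n}" "c' \<in> {0..n}" and ys: "ys \<in> positive_pairs n" "ys' \<in> positive_pairs n"
        and eq: "shift c ys = shift c' ys'"
      have arr: "ys \<in> arrangements {0..n}" "ys' \<in> arrangements {0..n}"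
        using ys by (auto simp: positive_pairs_def)
      note len = arrangement_upto[OF arr(1)] arrangement_upto[OF arr(2)]
      obtain p p' where p: "walk_min ys p" "ys ! p = 0" "walk_min ys' p'" "ys' ! p' = 0"
        using ys positive_pairs_iff arr by blast
      have "p = p'"
        using p eq walk_min_shift walk_min_unique by metis
      \<comment> \<open>Both words have 0 at the common minimum, so the entry of the shifted word
        there is the amount of the shift.\<close>
      then have "c = c'"
        using nth_shift[of p ys c] nth_shift[of p ys' c'] p eq len c by (simp add: walk_min_def)
      then show "c = c' \<and> ys = ys'"
        using inj_onD[OF inj_on_shift] eq len by blast
    qed
    show "(\<lambda>(c, ys). shift c ys) ` ({0..n} \<times> positive_pairs n) = arrangements {0..n}"
    proof (intro equalityI subsetI)
      fix zs assume "zs \<in> (\<lambda>(c, ys). shift c ys) ` ({0..n} \<times> positive_pairs n)"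
      then show "zs \<in> arrangements {0..n}"
        by (auto simp: positive_pairs_def shift_arrangement)
    next
      fix zs assume zs: "zs \<in> arrangements {0..n}"
      note len = arrangement_upto[OF zs]
      obtain p where p: "walk_min zs p"
        using walk_min_exists[OF len(3,2)] len(1) by force
      then have "p < length zs" by (simp add: walk_min_def)
      define c where "c = zs ! p"
      have c: "c < Suc n"
        using len \<open>p < length zs\<close> by (auto simp: c_def subset_iff)
      \<comment> \<open>Adding \<open>Suc n - c\<close> subtracts \<open>c\<close> modulo
        \<open>n + 1\<close>, so the entry at the minimum becomes 0, and shifting by
        \<open>c\<close> restores \<open>zs\<close>.\<close>
      define ys where "ys = shift (Suc n - c) zs"
      have arr: "ys \<in> arrangements {0..n}"
        unfolding ys_def by (rule shift_arrangement[OF zs])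
      have "ys ! p = 0"
        using nth_shift[OF \<open>p < length zs\<close>] c len(1) by (simp add: ys_def c_def)
      moreover have "walk_min ys p"
        using p by (simp add: ys_def walk_min_shift)
      ultimately have "ys \<in> positive_pairs n"
        using positive_pairs_iff[OF arr] by blast
      moreover have "shift c ys = zs"
      proof (rule nth_equalityI)
        fix i assume "i < length (shift c ys)"
        then have i: "i < length zs" by (simp add: ys_def)
        then have "zs ! i < Suc n" using len by (auto simp: subset_iff)
        then show "shift c ys ! i = zs ! i"
          using i c len(1) mod_add_self2[of "zs ! i" "Suc n"]
          by (simp add: ys_def nth_shift mod_add_left_eq)
      qed (simp add: ys_def)
      ultimately show "zs \<in> (\<lambda>(c, ys). shift c ys) ` ({0..n} \<times> positive_pairs n)"
        using c by (auto intro!: image_eqI[of _ _ "(c, ys)"])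
    qed
  qed
  from bij_betw_same_card[OF this] have "Suc n * card (positive_pairs n) = fact (Suc n)"
    by (simp add: card_cartesian_product arrangements_eq)
  then show ?thesis by (simp only: fact_Suc of_nat_id mult_cancel1) simp
qed

section \<open>The convolution identity\<close>

definition positive_count :: "nat \<Rightarrow> nat" where
  "positive_count n = card (positive_arrangements {1..n})"

text \<open>The set \<open>A\<close> of entries to the left of 0 is chosen first; the two sides are
  then independent positive words over \<open>A\<close> and its complement in
  \<open>{1..n}\<close>.\<close>

lemma positive_pairs_card_sum:
  "card (positive_pairs n) =
    (\<Sum>A | A \<subseteq> {1..n} \<and> even (card A). positive_count (card A) * positive_count (n - card A))"
proof -
  let ?S = "{A. A \<subseteq> {1..n} \<and> even (card A)}"
  let ?T = "SIGMA A:?S. positive_arrangements A \<times> positive_arrangements ({1..n} - A)"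
  have "bij_betw (\<lambda>(A, as, bs). rev as @ 0 # bs) ?T (positive_pairs n)"
    unfolding bij_betw_def
  proof
    show "inj_on (\<lambda>(A, as, bs). rev as @ 0 # bs) ?T"
    proof (rule inj_onI)
      fix x y
      assume xy: "x \<in> ?T" "y \<in> ?T"
        and f: "(\<lambda>(A, as, bs). rev as @ 0 # bs) x = (\<lambda>(A, as, bs). rev as @ 0 # bs) y"
      obtain A as bs A' as' bs' where x: "x = (A, as, bs)" and y: "y = (A', as', bs')"
        by (metis prod_cases3)
      have A: "A \<subseteq> {1..n}" "A' \<subseteq> {1..n}"
        and mem: "as \<in> positive_arrangements A" "as' \<in> positive_arrangements A'"
          "bs \<in> positive_arrangements ({1..n} - A)" "bs' \<in> positive_arrangements ({1..n} - A')"
        and eq: "rev as @ 0 # bs = rev as' @ 0 # bs'"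
        using xy f by (auto simp: x y)
      \<comment> \<open>The only 0 marks the cut, so both halves can be recovered.\<close>
      have "0 \<notin> set (rev as)" "0 \<notin> set bs"
        using A mem by (auto simp: positive_arrangements_def arrangements_def)
      then have "rev as = rev as' \<and> bs = bs'"
        using append_Cons_eq_iff[of 0 "rev as" bs "rev as'" bs'] eq by blast
      then show "x = y"
        using mem by (auto simp: x y positive_arrangements_def arrangements_def)
    qed
    show "(\<lambda>(A, as, bs). rev as @ 0 # bs) ` ?T = positive_pairs n"
    proof (intro equalityI subsetI)
      fix ys assume "ys \<in> (\<lambda>(A, as, bs). rev as @ 0 # bs) ` ?T"
      then obtain A as bs where A: "A \<subseteq> {1..n}" "even (card A)" and ys: "ys = rev as @ 0 # bs"
        and mem: "as \<in> positive_arrangements A" "bs \<in> positive_arrangements ({1..n} - A)"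
        by auto
      have "insert 0 {1..n} = {0..n}" by auto
      then have "ys \<in> arrangements {0..n}"
        using A mem ys by (auto simp: positive_arrangements_def arrangements_def)
      moreover have "even (length as)"
        using A mem length_arrangement by (auto simp: positive_arrangements_def)
      ultimately show "ys \<in> positive_pairs n"
        using ys mem by (auto simp: positive_pairs_def positive_arrangements_def)
    next
      fix ys assume "ys \<in> positive_pairs n"
      then obtain as bs where ys: "ys = rev as @ 0 # bs" "distinct ys" "set ys = {0..n}"
        and pos: "even (length as)" "positive_updown as" "positive_updown bs"
        by (auto simp: positive_pairs_def arrangements_def)
      have "{1..n} = {0..n} - {0}" by auto
      also have "\<dots> = set as \<union> set bs" unfolding ys(3)[symmetric] using ys(1,2) by auto
      finally have n: "{1..n} = set as \<union> set bs" .
      have "set as \<inter> set bs = {}" using ys(1,2) by auto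
      then have "set as \<subseteq> {1..n}" "set bs = {1..n} - set as" unfolding n by blast+
      moreover have "even (card (set as))"
        using pos(1) ys(1,2) by (simp add: distinct_card)
      ultimately show "ys \<in> (\<lambda>(A, as, bs). rev as @ 0 # bs) ` ?T"
        using pos ys(1,2)
        by (intro image_eqI[of _ _ "(set as, as, bs)"])
           (simp_all add: positive_arrangements_def arrangements_def)
    qed
  qed
  from bij_betw_same_card[OF this] have "card (positive_pairs n) = card ?T" by simp
  also have "\<dots> = (\<Sum>A\<in>?S. card (positive_arrangements A \<times> positive_arrangements ({1..n} - A)))"
    by (rule card_SigmaI) (auto simp: finite_positive_arrangements)
  also have "\<dots> = (\<Sum>A\<in>?S. positive_count (card A) * positive_count (n - card A))"
  proof (rule sum.cong, simp)
    fix A assume "A \<in> ?S"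
    then have A: "A \<subseteq> {1..n}" "finite A" using finite_subset by auto
    then have "card ({1..n} - A) = n - card A"
      by (simp add: card_Diff_subset)
    then show "card (positive_arrangements A \<times> positive_arrangements ({1..n} - A)) =
        positive_count (card A) * positive_count (n - card A)"
      using card_positive_arrangements[of A] card_positive_arrangements[of "{1..n} - A"] A
      by (simp add: card_cartesian_product positive_count_def)
  qed
  finally show ?thesis .
qed

lemma positive_count_convolution:
  "(\<Sum>k\<le>m. (2 * m choose (2 * k)) * (positive_count (2 * k) * positive_count (2 * (m - k)))) =
    fact (2 * m)"
proof -
  let ?S = "{A. A \<subseteq> {1..2 * m} \<and> even (card A)}"
  let ?f = "\<lambda>A :: nat set. positive_count (card A) * positive_count (2 * m - card A)"
  have fin: "finite ?S" by simp
  have "card A \<le> 2 * m" if "A \<subseteq> {1..2 * m}" for A :: "nat set"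
    using card_mono[OF _ that] by simp
  then have sub: "(\<lambda>A. card A div 2) ` ?S \<subseteq> {..m}"
    by (simp add: image_subset_iff div_le_mono[of _ "2 * m" 2, simplified])
  have "fact (2 * m) = (\<Sum>A\<in>?S. ?f A)"
    using positive_pairs_card_sum[of "2 * m"] card_positive_pairs[of "2 * m"] by simp
  \<comment> \<open>On sets of even size, \<open>card A div 2\<close> determines the size, so each
    group consists of all subsets with \<open>2 * k\<close> elements.\<close>
  also have "\<dots> = (\<Sum>k\<le>m. \<Sum>A | A \<in> ?S \<and> card A div 2 = k. ?f A)"
    by (rule sum.group[OF fin _ sub, symmetric]) simp
  also have "\<dots> = (\<Sum>k\<le>m. (2 * m choose (2 * k)) * (positive_count (2 * k) * positive_count (2 * (m - k))))"
  proof (rule sum.cong, simp)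
    fix k assume "k \<in> {..m}"
    have eq: "{A. A \<in> ?S \<and> card A div 2 = k} = {A. A \<subseteq> {1..2 * m} \<and> card A = 2 * k}"
      by auto
    have "(\<Sum>A | A \<in> ?S \<and> card A div 2 = k. ?f A) =
        (\<Sum>A | A \<subseteq> {1..2 * m} \<and> card A = 2 * k. positive_count (2 * k) * positive_count (2 * (m - k)))"
      unfolding eq by (rule sum.cong) (auto simp: right_diff_distrib')
    then show "(\<Sum>A | A \<in> ?S \<and> card A div 2 = k. ?f A) =
        (2 * m choose (2 * k)) * (positive_count (2 * k) * positive_count (2 * (m - k)))"
      using n_subsets[of "{1..2 * m}" "2 * k"] by simp
  qed
  finally show ?thesis by simp
qed

section \<open>Solving the convolution identity\<close>

text \<open>A power series with constant term 1 is determined by its square: for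
  \<open>m > 0\<close> the unknown \<open>p m\<close> enters the coefficient only through the two
  end terms, as \<open>2 * p m\<close>, and the other terms involve smaller indices.\<close>

lemma convolution_square_root_unique:
  fixes p q :: "nat \<Rightarrow> real"
  assumes "p 0 = 1" "q 0 = 1"
    and "\<And>m. (\<Sum>k\<le>m. p k * p (m - k)) = (\<Sum>k\<le>m. q k * q (m - k))"
  shows "p m = q m"
proof (induction m rule: less_induct)
  case (less m)
  show ?case
  proof (cases m)
    case (Suc l)
    have split: "(\<Sum>k\<le>m. f k * f (m - k)) = 2 * f m + (\<Sum>k=1..l. f k * f (m - k))"
      if "f 0 = 1" for f :: "nat \<Rightarrow> real"
    proof -
      have "{..m} = insert 0 (insert m {1..l})" using Suc by auto
      then show ?thesis using Suc that by simp
    qed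
    have "(\<Sum>k=1..l. p k * p (m - k)) = (\<Sum>k=1..l. q k * q (m - k))"
      using less Suc by (intro sum.cong) auto
    then show ?thesis
      using assms(3)[of m] split[of p] split[of q] assms(1,2) by simp
  qed (simp add: assms)
qed

text \<open>The factors are the coefficients of \<open>(1 - x)\<close> to the power -1/2. The square
  of that series is \<open>1 / (1 - x)\<close>, with all coefficients 1; Vandermonde's identity
  expresses this as \<open>-1/2 - 1/2 = -1\<close>.\<close>

lemma gbinomial_minus_half_convolution:
  "(\<Sum>k\<le>m. ((-1) ^ k * ((- 1 / 2 :: real) gchoose k)) *
    ((-1) ^ (m - k) * ((- 1 / 2) gchoose (m - k)))) = 1"
proof -
  have "(\<Sum>k\<le>m. ((-1) ^ k * ((- 1 / 2 :: real) gchoose k)) *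
        ((-1) ^ (m - k) * ((- 1 / 2) gchoose (m - k))))
      = (\<Sum>k\<le>m. (-1) ^ m * (((- 1 / 2) gchoose k) * ((- 1 / 2) gchoose (m - k))))"
  proof (rule sum.cong)
    fix k assume "k \<in> {..m}"
    then have "(-1 :: real) ^ m = (-1) ^ k * (-1) ^ (m - k)" by (simp flip: power_add)
    then show "((-1) ^ k * ((- 1 / 2 :: real) gchoose k)) * ((-1) ^ (m - k) * ((- 1 / 2) gchoose (m - k))) =
        (-1) ^ m * (((- 1 / 2) gchoose k) * ((- 1 / 2) gchoose (m - k)))"
      by (simp only: mult_ac)
  qed simp
  also have "\<dots> = (-1) ^ m * ((- 1) gchoose m)"
    using gbinomial_Vandermonde[of "- 1 / 2 :: real" "- 1 / 2" m]
    by (simp add: sum_distrib_left[symmetric] atLeast0AtMost)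
  also have "\<dots> = 1"
    \<comment> \<open>Upper negation turns \<open>(- 1) gchoose m\<close> into
      \<open>(-1) ^ m\<close> times \<open>m choose m\<close>, and the two signs cancel.\<close>
    by (simp add: gbinomial_minus[of "1 :: real" m] flip: binomial_gbinomial power_mult_distrib mult.assoc)
  finally show ?thesis .
qed

text \<open>From \<open>k\<close> to \<open>k + 1\<close> both sides gain the factor
  \<open>(2 * k + 1)\<^sup>2\<close>: on the right, \<open>(2 * k + 2) * (2 * k + 1)\<close> from
  the factorial and \<open>(2 * k + 1) / (2 * k + 2)\<close> from the signed binomial
  coefficient.\<close>

lemma dfact_odd_square:
  "real ((dfact (2 * k - 1))\<^sup>2) = fact (2 * k) * ((-1) ^ k * ((- 1 / 2) gchoose k))"
proof (induction k)
  case (Suc k)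
  \<comment> \<open>For \<open>k = 0\<close> truncated subtraction gives \<open>dfact 0\<close>,
    which stands for (-1)!! = 1.\<close>
  have "dfact (2 * Suc k - 1) = (2 * k + 1) * dfact (2 * k - 1)"
    by (cases k) auto
  moreover have "((- 1 / 2 :: real) gchoose Suc k) =
      ((- 1 / 2) gchoose k) * (- 1 / 2 - real k) / (real k + 1)"
    by (simp add: gbinomial_prod_rev field_simps)
  moreover have "fact (2 * Suc k) = (2 * real k + 2) * (2 * real k + 1) * fact (2 * k)"
    by (simp add: algebra_simps)
  ultimately have "real ((dfact (2 * Suc k - 1))\<^sup>2) =
      (2 * real k + 1)\<^sup>2 * (fact (2 * k) * ((-1) ^ k * ((- 1 / 2) gchoose k)))"
    using Suc by (simp only: of_nat_power of_nat_mult of_nat_add power_mult_distrib of_nat_numeral of_nat_1)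
  also have "\<dots> = fact (2 * Suc k) * ((-1) ^ Suc k * ((- 1 / 2) gchoose Suc k))"
    unfolding \<open>fact (2 * Suc k) = _\<close> \<open>((- 1 / 2 :: real) gchoose Suc k) = _\<close>
    by (simp add: field_simps power2_eq_square)
  finally show ?case .
qed simp

lemma positive_count_0: "positive_count 0 = 1"
proof -
  have "positive_arrangements {} = {[]}"
    by (auto simp: positive_arrangements_def arrangements_def positive_updown_def)
  then show ?thesis by (simp add: positive_count_def)
qed

text \<open>Division by \<open>fact (2 * k)\<close> absorbs the binomial coefficients of the
  convolution identity and leaves the equation already solved by the coefficients for exponent
  -1/2.\<close>

lemma positive_count_even: "positive_count (2 * m) = (dfact (2 * m - 1))\<^sup>2"
proof -
  define p where "p k = real (positive_count (2 * k)) / fact (2 * k)" for k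
  have "(\<Sum>k\<le>m. p k * p (m - k)) = 1" for m
  proof -
    have "(\<Sum>k\<le>m. p k * p (m - k)) = (\<Sum>k\<le>m. real ((2 * m choose (2 * k)) *
        (positive_count (2 * k) * positive_count (2 * (m - k)))) / fact (2 * m))"
      by (rule sum.cong) (auto simp: p_def binomial_fact right_diff_distrib')
    also have "\<dots> = real (\<Sum>k\<le>m. (2 * m choose (2 * k)) *
        (positive_count (2 * k) * positive_count (2 * (m - k)))) / fact (2 * m)"
      by (simp add: sum_divide_distrib)
    finally show ?thesis by (simp add: positive_count_convolution)
  qed
  then have "p m = (-1) ^ m * ((- 1 / 2) gchoose m)"
    by (intro convolution_square_root_unique[where q = "\<lambda>m. (-1) ^ m * ((- 1 / 2) gchoose m)"])
       (simp_all only: gbinomial_minus_half_convolution, simp_all add: p_def positive_count_0)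
  then have "real (positive_count (2 * m)) = real ((dfact (2 * m - 1))\<^sup>2)"
    unfolding dfact_odd_square p_def by (simp add: field_simps)
  then show ?thesis by (simp only: of_nat_eq_iff)
qed

section \<open>Deleting the last entry: odd lengths and Dyck sequences\<close>

lemma asc_below_butlast:
  assumes "j < length xs"
  shows "asc_below (butlast xs) j = asc_below xs j" "desc_below (butlast xs) j = desc_below xs j"
proof -
  have "is_ascent (butlast xs) i \<longleftrightarrow> is_ascent xs i"
    "is_descent (butlast xs) i \<longleftrightarrow> is_descent xs i" if "i < j" for i
    using that assms by (auto simp: is_ascent_def is_descent_def nth_butlast)
  then show "asc_below (butlast xs) j = asc_below xs j" "desc_below (butlast xs) j = desc_below xs j"
    unfolding asc_below_def desc_below_def by (metis (no_types, lifting))+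
qed

text \<open>The last entry is any of \<open>n\<close> values, and what precedes it is a positive
  word over the other \<open>n - 1\<close> values.\<close>

lemma card_positive_butlast:
  assumes "n \<ge> 1"
  shows "card {xs \<in> perms n. positive_updown (butlast xs)} = n * positive_count (n - 1)"
proof -
  let ?T = "SIGMA v:{1..n}. positive_arrangements ({1..n} - {v})"
  have "bij_betw (\<lambda>(v, xs). xs @ [v]) ?T {xs \<in> perms n. positive_updown (butlast xs)}"
  proof (rule bij_betwI[of _ _ _ "\<lambda>xs. (last xs, butlast xs)"])
    have "xs @ [v] \<in> perms n" if "v \<in> {1..n}" "xs \<in> positive_arrangements ({1..n} - {v})" for v xs
    proof -
      have "insert v ({1..n} - {v}) = {1..n}" using that(1) by blast
      then show ?thesis
        using that(2) by (simp add: positive_arrangements_def arrangements_def perms_def)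
    qed
    then show "(\<lambda>(v, xs). xs @ [v]) \<in> ?T \<rightarrow> {xs \<in> perms n. positive_updown (butlast xs)}"
      by (auto simp: positive_arrangements_def)
    have "(last xs, butlast xs) \<in> ?T" if "xs \<in> perms n" "positive_updown (butlast xs)" for xs
    proof -
      have "xs \<noteq> []" using that assms by (auto simp: perms_def)
      then obtain ys v where xs: "xs = ys @ [v]" by (metis rev_exhaust)
      then have "insert v (set ys) = {1..n}" "distinct ys" "v \<notin> set ys"
        using that(1) by (simp_all add: perms_def)
      moreover from this have "v \<in> {1..n}" "set ys = {1..n} - {v}" by blast+
      ultimately show ?thesis
        using that(2) xs by (simp add: positive_arrangements_def arrangements_def)
    qed
    then show "(\<lambda>xs. (last xs, butlast xs)) \<in> {xs \<in> perms n. positive_updown (butlast xs)} \<rightarrow> ?T"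
      by blast
    show "(case (last xs, butlast xs) of (v, xs) \<Rightarrow> xs @ [v]) = xs"
      if "xs \<in> {xs \<in> perms n. positive_updown (butlast xs)}" for xs
      using that assms by (cases "xs = []") (auto simp: perms_def)
  qed auto
  from bij_betw_same_card[OF this]
  have "card {xs \<in> perms n. positive_updown (butlast xs)} = card ?T" by simp
  also have "\<dots> = (\<Sum>v\<in>{1..n}. card (positive_arrangements ({1..n} - {v})))"
    by (rule card_SigmaI) (auto simp: finite_positive_arrangements)
  also have "\<dots> = (\<Sum>v\<in>{1..n}. positive_count (n - 1))"
  proof (rule sum.cong, simp)
    fix v assume "v \<in> {1..n}"
    then show "card (positive_arrangements ({1..n} - {v})) = positive_count (n - 1)"
      using card_positive_arrangements[of "{1..n} - {v}"] by (simp add: positive_count_def)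
  qed
  finally show ?thesis by simp
qed

lemma positive_count_perms: "card {xs \<in> perms n. positive_updown xs} = positive_count n"
  by (simp add: positive_count_def positive_arrangements_def arrangements_def perms_def)

lemma positive_updown_butlast_iff:
  assumes "xs \<noteq> []"
  shows "positive_updown (butlast xs) \<longleftrightarrow> (\<forall>j<length xs. asc_below xs j \<le> desc_below xs j)"
proof -
  have "j \<le> length (butlast xs) \<longleftrightarrow> j < length xs" for j
    using assms by (cases xs) auto
  then show ?thesis
    by (simp add: positive_updown_def asc_below_butlast cong: imp_cong)
qed

lemma perms_props:
  assumes "xs \<in> perms n"
  shows "distinct xs" "length xs = n"
  using assms distinct_card[of xs] by (auto simp: perms_def)

text \<open>By \<open>positive_updown_iff\<close> only prefixes of even length matter, and for odd
  \<open>n\<close> all of them avoid the last entry. So the count is \<open>n\<close> times the even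
  count for \<open>n - 1\<close>.\<close>

lemma positive_count_odd:
  assumes "odd n"
  shows "positive_count n = dfact n * dfact (n - 2)"
proof -
  have n: "n \<ge> 1" using assms by (cases n) auto
  have "{xs \<in> perms n. positive_updown xs} = {xs \<in> perms n. positive_updown (butlast xs)}"
  proof (intro Collect_cong conj_cong refl)
    fix xs assume "xs \<in> perms n"
    note xs = perms_props[OF this]
    have "xs \<noteq> []" using xs n by auto
    have "2 * k \<le> length xs \<longleftrightarrow> 2 * k \<le> length (butlast xs)" for k
      using assms xs by (auto elim!: oddE)
    moreover have "asc_below (butlast xs) (2 * k) = asc_below xs (2 * k)" if "2 * k \<le> length (butlast xs)" for k
      using that \<open>xs \<noteq> []\<close> by (intro asc_below_butlast) (cases "length xs", auto)
    ultimately show "positive_updown xs \<longleftrightarrow> positive_updown (butlast xs)"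
      using positive_updown_iff[OF xs(1)] positive_updown_iff[OF distinct_butlast[OF xs(1)]] by auto
  qed
  then have "positive_count n = n * positive_count (n - 1)"
    using card_positive_butlast[OF n] positive_count_perms[of n] by simp
  also obtain m where m: "n = 2 * m + 1" using assms by (auto elim!: oddE)
  \<comment> \<open>The case \<open>m = 0\<close> is \<open>n = 1\<close>, where
    \<open>n - 2\<close> truncates to 0 and \<open>dfact 0\<close> again stands for (-1)!!.\<close>
  have "n * positive_count (n - 1) = dfact n * dfact (n - 2)"
    using positive_count_even[of m] m by (cases m) (auto simp: power2_eq_square algebra_simps)
  finally show ?thesis .
qed

text \<open>If all proper prefixes have non-negative height, the final height is at least -1: it is
  -1 for a Dyck sequence and non-negative for a positive one. Height -1 after \<open>n - 1\<close>
  unit steps forces \<open>n\<close> to be even.\<close>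

lemma dyck_updown_iff:
  assumes "xs \<in> perms n" "n \<ge> 1"
  shows "dyck_updown xs \<longleftrightarrow> even n \<and> positive_updown (butlast xs) \<and> \<not> positive_updown xs"
proof -
  note xs = perms_props[OF assms(1)]
  have ne: "xs \<noteq> []" using xs assms(2) by auto
  have sum: "asc_below xs n + desc_below xs n + 1 = n"
    using asc_plus_desc_below[OF xs(1), of n] xs(2) assms(2) by simp
  have last: "asc_below xs n \<le> desc_below xs n + 1" if "asc_below xs (n - 1) \<le> desc_below xs (n - 1)"
  proof (cases "n = 1")
    case False
    then show ?thesis
      using that asc_below_Suc[of "n - 1" xs] desc_below_Suc[of "n - 1" xs] xs(2) assms(2) by auto
  qed simp
  have "positive_updown xs \<longleftrightarrow> positive_updown (butlast xs) \<and> asc_below xs n \<le> desc_below xs n"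
    unfolding positive_updown_butlast_iff[OF ne] using xs(2) by (auto simp: positive_updown_def le_less)
  moreover have "dyck_updown xs \<longleftrightarrow> positive_updown (butlast xs) \<and> asc_below xs n = desc_below xs n + 1"
    unfolding positive_updown_butlast_iff[OF ne] dyck_updown_def
    using asc_below_length[of xs] desc_below_length[of xs] xs(2) by auto
  moreover have "asc_below xs (n - 1) \<le> desc_below xs (n - 1)" if "positive_updown (butlast xs)"
    using that positive_updown_butlast_iff[OF ne] xs(2) assms(2) by auto
  moreover have "even n" if "asc_below xs n = desc_below xs n + 1"
    using sum that by presburger
  ultimately show ?thesis using last by force
qed

theorem theorem6:
  fixes n :: nat
  assumes "n \<ge> 1"
  shows "card {xs \<in> perms n. positive_updown xs} =
           (if even n then (dfact (n - 1))^2 else dfact n * dfact (n - 2)) \<and>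
         card {xs \<in> perms n. dyck_updown xs} =
           (if even n then dfact (n - 1) * dfact (n - 3) else 0)"
proof
  show "card {xs \<in> perms n. positive_updown xs} =
      (if even n then (dfact (n - 1))^2 else dfact n * dfact (n - 2))"
    using positive_count_even positive_count_odd positive_count_perms by (auto elim!: evenE)
  show "card {xs \<in> perms n. dyck_updown xs} = (if even n then dfact (n - 1) * dfact (n - 3) else 0)"
  proof (cases "even n")
    case False
    then have "{xs \<in> perms n. dyck_updown xs} = {}"
      using dyck_updown_iff assms by auto
    then show ?thesis using False by (simp only: card.empty if_False)
  next
    case True
    then obtain m where m: "n = 2 * Suc m"
      using assms by (metis One_nat_def Suc_pred evenE mult_0_right not_gr_zero not_one_le_zero)
    have sub: "{xs \<in> perms n. positive_updown xs} \<subseteq> {xs \<in> perms n. positive_updown (butlast xs)}"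
    proof clarify
      fix xs assume xs: "xs \<in> perms n" "positive_updown xs"
      have "xs \<noteq> []" using perms_props[OF xs(1)] assms by auto
      then show "positive_updown (butlast xs)"
        using xs(2) positive_updown_butlast_iff[of xs] by (auto simp: positive_updown_def)
    qed
    have fin: "finite {xs \<in> perms n. positive_updown xs}"
      using finite_positive_arrangements[of "{1..n}"]
      by (simp add: positive_arrangements_def arrangements_def perms_def)
    \<comment> \<open>For even \<open>n\<close> the Dyck words are those positive before the last
      entry but not positive overall, so their number is a difference of two known counts.\<close>
    have "{xs \<in> perms n. dyck_updown xs} =
        {xs \<in> perms n. positive_updown (butlast xs)} - {xs \<in> perms n. positive_updown xs}"
      using dyck_updown_iff[OF _ assms] True by blast
    then have "card {xs \<in> perms n. dyck_updown xs} = n * positive_count (n - 1) - positive_count n"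
      using card_Diff_subset[OF fin sub] card_positive_butlast[OF assms] positive_count_perms by simp
    also have "\<dots> = n * (dfact (n - 1) * dfact (n - 3)) - (dfact (n - 1))\<^sup>2"
      using positive_count_odd[of "n - 1"] positive_count_even[of "Suc m"] m by (simp add: numeral_3_eq_3)
    finally have count: "card {xs \<in> perms n. dyck_updown xs} =
        n * (dfact (n - 1) * dfact (n - 3)) - (dfact (n - 1))\<^sup>2" .
    \<comment> \<open>For \<open>m = 0\<close>, that is \<open>n = 2\<close>, the argument
      \<open>n - 3\<close> truncates to 0 and the recursion reads 1 = 1 * 1.\<close>
    have rec: "dfact (n - 1) = (n - 1) * dfact (n - 3)"
    proof (cases m)
      case (Suc k)
      then have "n - 1 = Suc (Suc (Suc (2 * k)))" "n - 3 = Suc (2 * k)" using m by auto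
      then show ?thesis by (simp only: dfact.simps)
    qed (simp add: m)
    have "(dfact (n - 1))\<^sup>2 = dfact (n - 1) * ((n - 1) * dfact (n - 3))"
      unfolding power2_eq_square by (rule arg_cong[OF rec])
    \<comment> \<open>With \<open>a = dfact (n - 1)\<close> and \<open>b = dfact (n - 3)\<close>,
      the count is \<open>n * a * b - (n - 1) * a * b\<close>, in which a single
      \<open>a * b\<close> survives.\<close>
    then have "card {xs \<in> perms n. dyck_updown xs} = (n - (n - 1)) * (dfact (n - 1) * dfact (n - 3))"
      unfolding count diff_mult_distrib[of n "n - 1"] by (simp only: mult.left_commute)
    then show ?thesis using True assms by simp
  qed
qed

end
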